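(* The category $\mathcal{C}_{TCM}$ of topos causal models, and its special case the category $\mathcal{C}_{SCM}$ of structural causal models, are both complete and cocomplete, i.e. in each of them every diagram indexed by a small category has a limit and a colimit.
   Context: Category $\mathcal{C}_{TCM}$. An object is a triple $\langle U, V, F\rangle$, where $U$ is the set of (realizations of) the exogenous variables, $V$ is the set of (realizations of) the endogenous variables, and $F: U \to V$ is a function; thus an object is abstractly just a function of sets $F: U\to V$. A morphism from $f: U\to V$ to $f': U'\to V'$ is a pair of functions $\langle h, g\rangle$ with $h: U\to U'$ and $g: V\to V'$ such that $g\circ f = f'\circ h$. Composition and identities are componentwise. Category $\mathcal{C}_{SCM}$. An object (a structural causal model) consists of a set $U$ of realizations of the exogenous variables; finitely many endogenous variables $V_1,\dots,V_n$, where we also write $V_i$ for the set of values of the $i$-th variable and $V=\prod_{i=1}^n V_i$ for the set of realizations of all the endogenous variables; and local functions $f_1,\dots,f_n$, with $f_i: U\times\prod_{j\neq i}V_j\to V_i$, which together induce a unique function $F: U\to V$, in the sense that for every $u\in U$ there is exactly one $v=(v_1,\dots,v_n)\in V$ with $v_i=f_i(u,(v_j)_{j\ne i})$ for all $i$, and $F(u)=v$. Morphisms between structural causal models are, as in $\mathcal{C}_{TCM}$, the pairs of functions $\langle h,g\rangle$, $h: U\to U'$, $g: V\to V'$, such that $g\circ F=F'\circ h$ for the induced functions $F: U\to V$ and $F': U'\to V'$. *)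

theory Defs
  imports "HOL-Library.FuncSet" "HOL-Library.Equipollence"
begin

section \<open>Universes of sets\<close>

text \<open>
  HOL has no type of all sets, so ``set'' and ``small'' are relative to a universe: \<open>\<U>\<close> is the
  collection of sets from which objects are built, and \<open>\<S>\<close> the collection of small sets over
  which diagrams are indexed. The axioms say that every finite cardinality is small, that \<open>\<U>\<close> is
  closed under passing to a set that injects into a member (subsets, isomorphic copies, quotients)
  and that, up to bijection, \<open>\<U>\<close> is closed under disjoint unions and products of small families.
  A Grothendieck universe is the case \<open>\<S> = \<U>\<close>, i.e. \<^term>\<open>set_universe \<U> \<U>\<close>. The two
  collections are kept apart because HOL alone cannot exhibit an infinite Grothendieck universe,
  whereas \<open>set_universe_UNIV\<close> below provides a universe for small index sets of any prescribed
  size and for sets of any prescribed size.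
\<close>

definition set_universe :: "'s set set \<Rightarrow> 'a set set \<Rightarrow> bool" where
  "set_universe \<S> \<U> \<longleftrightarrow>
     (\<forall>n::nat. \<exists>S\<in>\<S>. S \<approx> {..<n}) \<and>
     (\<forall>A\<in>\<U>. \<forall>B. B \<lesssim> A \<longrightarrow> B \<in> \<U>) \<and>
     (\<forall>I\<in>\<S>. \<forall>X. (\<forall>i\<in>I. X i \<in> \<U>) \<longrightarrow>
        (\<exists>A\<in>\<U>. A \<approx> (SIGMA i:I. X i)) \<and> (\<exists>A\<in>\<U>. A \<approx> (\<Pi>\<^sub>E i\<in>I. X i)))"

lemma set_universe_UNIV:
  assumes "infinite (UNIV :: 'i set)"
  shows "set_universe (UNIV :: 'i set set) (UNIV :: ('i \<times> 'b) set set set)"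
proof -
  have fin: "\<exists>S :: 'i set. S \<approx> {..<n}" for n :: nat
    using infinite_arbitrarily_large[OF assms, of n] by (auto simp: eqpoll_iff_finite_card)
  have "(UNIV :: 'i set) \<times> (UNIV :: 'i set) \<approx> (UNIV :: 'i set)"
    unfolding eqpoll_iff_card_of_ordIso using card_of_Times_same_infinite[OF assms] .
  then obtain e :: "'i \<times> 'i \<Rightarrow> 'i" where e: "inj e"
    by (auto simp: eqpoll_def bij_betw_def)
  define code :: "('i \<Rightarrow> ('i \<times> 'b) set) \<Rightarrow> ('i \<times> 'b) set"
    where "code x = {(e (i, j), b) | i j b. (j, b) \<in> x i}" for x
  have decode: "(e (i, j), b) \<in> code x \<longleftrightarrow> (j, b) \<in> x i" for x i j b
    using injD[OF e] by (auto simp: code_def)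
  have code: "inj code"
  proof (rule injI)
    fix x y assume "code x = code y"
    then have "(j, b) \<in> x i \<longleftrightarrow> (j, b) \<in> y i" for i j b
      unfolding decode[symmetric] by (simp only:)
    then show "x = y" by (intro ext set_eqI) (simp only: split_paired_all)
  qed
  obtain i0 i1 :: 'i where i01: "i0 \<noteq> i1"
    using infinite_arbitrarily_large[OF assms, of 2] by (auto simp: card_2_iff)
  define sing :: "'i \<Rightarrow> ('i \<times> 'b) set" where "sing i = {(i, undefined)}" for i
  define pair :: "'i \<times> ('i \<times> 'b) set \<Rightarrow> ('i \<Rightarrow> ('i \<times> 'b) set)"
    where "pair = (\<lambda>(i, x). (\<lambda>_. {})(i0 := sing i, i1 := x))"
  have pair: "inj pair"
  proof (rule injI, clarify)
    fix i x j y assume "pair (i, x) = pair (j, y)"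
    then have "pair (i, x) i0 = pair (j, y) i0" "pair (i, x) i1 = pair (j, y) i1" by simp_all
    then show "i = j \<and> x = y" using i01 by (simp add: pair_def sing_def)
  qed
  have sig: "(code \<circ> pair) ` (SIGMA i:I. X i) \<approx> (SIGMA i:I. X i)" for I X
    by (rule inj_on_image_eqpoll_self, rule inj_on_subset[OF inj_compose[OF code pair] subset_UNIV])
  have pie: "code ` (\<Pi>\<^sub>E i\<in>I. X i) \<approx> (\<Pi>\<^sub>E i\<in>I. X i)" for I X
    by (rule inj_on_image_eqpoll_self, rule inj_on_subset[OF code subset_UNIV])
  show ?thesis
    unfolding set_universe_def
  proof (intro conjI allI ballI impI)
    show "\<exists>S\<in>UNIV. (S :: 'i set) \<approx> {..<n}" for n :: nat
      using fin[of n] by simp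
    show "\<exists>A\<in>UNIV. (A :: ('i \<times> 'b) set set) \<approx> (SIGMA i:I. X i)"
      for I :: "'i set" and X :: "'i \<Rightarrow> ('i \<times> 'b) set set"
      by (rule bexI, rule sig) (rule UNIV_I)
    show "\<exists>A\<in>UNIV. (A :: ('i \<times> 'b) set set) \<approx> (\<Pi>\<^sub>E i\<in>I. X i)"
      for I :: "'i set" and X :: "'i \<Rightarrow> ('i \<times> 'b) set set"
      by (rule bexI, rule pie) (rule UNIV_I)
  qed (rule UNIV_I)
qed

lemma ex_finite_eqpoll:
  assumes "infinite (UNIV :: 'a set)" and "finite B"
  shows "\<exists>A\<in>{A :: 'a set. finite A}. A \<approx> B"
proof -
  obtain A :: "'a set" where "finite A" "card A = card B"
    using infinite_arbitrarily_large[OF assms(1), of "card B"] by blast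
  then show ?thesis using assms(2) eqpoll_iff_card[of A B] by blast
qed

lemma set_universe_finite:
  assumes "infinite (UNIV :: 'a set)"
  shows "set_universe {A :: 'a set. finite A} {A :: 'a set. finite A}"
  unfolding set_universe_def
proof (intro conjI allI ballI impI)
  show "B \<in> {A. finite A}" if "A \<in> {A. finite A}" "B \<lesssim> A" for A B :: "'a set"
    using that by (auto simp: lepoll_def intro: inj_on_finite)
qed (rule ex_finite_eqpoll[OF assms], simp add: finite_PiE)+


section \<open>Categories, limits and colimits\<close>

text \<open>
  Hom-sets are not required to be disjoint: composition and the action of a functor on morphisms
  take the objects involved as arguments. \<open>Comp C a b c g f\<close> is the composite of \<open>f : a \<rightarrow> b\<close>
  and \<open>g : b \<rightarrow> c\<close>.
\<close>

record ('o, 'm) category =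
  Obj :: "'o set"
  Hom :: "'o \<Rightarrow> 'o \<Rightarrow> 'm set"
  Ident :: "'o \<Rightarrow> 'm"
  Comp :: "'o \<Rightarrow> 'o \<Rightarrow> 'o \<Rightarrow> 'm \<Rightarrow> 'm \<Rightarrow> 'm"

definition is_category :: "('o, 'm) category \<Rightarrow> bool" where
  "is_category C \<longleftrightarrow>
     (\<forall>a\<in>Obj C. Ident C a \<in> Hom C a a) \<and>
     (\<forall>a\<in>Obj C. \<forall>b\<in>Obj C. \<forall>c\<in>Obj C. \<forall>f\<in>Hom C a b. \<forall>g\<in>Hom C b c.
        Comp C a b c g f \<in> Hom C a c) \<and>
     (\<forall>a\<in>Obj C. \<forall>b\<in>Obj C. \<forall>f\<in>Hom C a b.
        Comp C a a b f (Ident C a) = f \<and> Comp C a b b (Ident C b) f = f) \<and>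
     (\<forall>a\<in>Obj C. \<forall>b\<in>Obj C. \<forall>c\<in>Obj C. \<forall>d\<in>Obj C.
        \<forall>f\<in>Hom C a b. \<forall>g\<in>Hom C b c. \<forall>h\<in>Hom C c d.
        Comp C a b d (Comp C b c d h g) f = Comp C a c d h (Comp C a b c g f))"

definition small_category :: "'s set set \<Rightarrow> ('s, 's) category \<Rightarrow> bool" where
  "small_category \<S> J \<longleftrightarrow>
     is_category J \<and> Obj J \<in> \<S> \<and> (\<forall>i\<in>Obj J. \<forall>j\<in>Obj J. Hom J i j \<in> \<S>)"

definition is_diagram ::
  "('j, 'k) category \<Rightarrow> ('o, 'm) category \<Rightarrow> ('j \<Rightarrow> 'o) \<Rightarrow> ('j \<Rightarrow> 'j \<Rightarrow> 'k \<Rightarrow> 'm) \<Rightarrow> bool" where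
  "is_diagram J C D E \<longleftrightarrow>
     (\<forall>i\<in>Obj J. D i \<in> Obj C) \<and>
     (\<forall>i\<in>Obj J. \<forall>j\<in>Obj J. \<forall>a\<in>Hom J i j. E i j a \<in> Hom C (D i) (D j)) \<and>
     (\<forall>i\<in>Obj J. E i i (Ident J i) = Ident C (D i)) \<and>
     (\<forall>i\<in>Obj J. \<forall>j\<in>Obj J. \<forall>k\<in>Obj J. \<forall>a\<in>Hom J i j. \<forall>b\<in>Hom J j k.
        E i k (Comp J i j k b a) = Comp C (D i) (D j) (D k) (E j k b) (E i j a))"

definition is_cone ::
  "('j, 'k) category \<Rightarrow> ('o, 'm) category \<Rightarrow> ('j \<Rightarrow> 'o) \<Rightarrow> ('j \<Rightarrow> 'j \<Rightarrow> 'k \<Rightarrow> 'm) \<Rightarrow>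
   'o \<Rightarrow> ('j \<Rightarrow> 'm) \<Rightarrow> bool" where
  "is_cone J C D E c p \<longleftrightarrow>
     c \<in> Obj C \<and>
     (\<forall>i\<in>Obj J. p i \<in> Hom C c (D i)) \<and>
     (\<forall>i\<in>Obj J. \<forall>j\<in>Obj J. \<forall>a\<in>Hom J i j. Comp C c (D i) (D j) (E i j a) (p i) = p j)"

definition is_limit ::
  "('j, 'k) category \<Rightarrow> ('o, 'm) category \<Rightarrow> ('j \<Rightarrow> 'o) \<Rightarrow> ('j \<Rightarrow> 'j \<Rightarrow> 'k \<Rightarrow> 'm) \<Rightarrow>
   'o \<Rightarrow> ('j \<Rightarrow> 'm) \<Rightarrow> bool" where
  "is_limit J C D E c p \<longleftrightarrow>
     is_cone J C D E c p \<and>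
     (\<forall>d q. is_cone J C D E d q \<longrightarrow>
        (\<exists>!m. m \<in> Hom C d c \<and> (\<forall>i\<in>Obj J. Comp C d c (D i) (p i) m = q i)))"

definition is_cocone ::
  "('j, 'k) category \<Rightarrow> ('o, 'm) category \<Rightarrow> ('j \<Rightarrow> 'o) \<Rightarrow> ('j \<Rightarrow> 'j \<Rightarrow> 'k \<Rightarrow> 'm) \<Rightarrow>
   'o \<Rightarrow> ('j \<Rightarrow> 'm) \<Rightarrow> bool" where
  "is_cocone J C D E c p \<longleftrightarrow>
     c \<in> Obj C \<and>
     (\<forall>i\<in>Obj J. p i \<in> Hom C (D i) c) \<and>
     (\<forall>i\<in>Obj J. \<forall>j\<in>Obj J. \<forall>a\<in>Hom J i j. Comp C (D i) (D j) c (p j) (E i j a) = p i)"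

definition is_colimit ::
  "('j, 'k) category \<Rightarrow> ('o, 'm) category \<Rightarrow> ('j \<Rightarrow> 'o) \<Rightarrow> ('j \<Rightarrow> 'j \<Rightarrow> 'k \<Rightarrow> 'm) \<Rightarrow>
   'o \<Rightarrow> ('j \<Rightarrow> 'm) \<Rightarrow> bool" where
  "is_colimit J C D E c p \<longleftrightarrow>
     is_cocone J C D E c p \<and>
     (\<forall>d q. is_cocone J C D E d q \<longrightarrow>
        (\<exists>!m. m \<in> Hom C c d \<and> (\<forall>i\<in>Obj J. Comp C (D i) c d m (p i) = q i)))"

definition complete_category :: "'s set set \<Rightarrow> ('o, 'm) category \<Rightarrow> bool" where
  "complete_category \<S> C \<longleftrightarrow>
     is_category C \<and>
     (\<forall>J D E. small_category \<S> J \<and> is_diagram J C D E \<longrightarrow> (\<exists>c p. is_limit J C D E c p))"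

definition cocomplete_category :: "'s set set \<Rightarrow> ('o, 'm) category \<Rightarrow> bool" where
  "cocomplete_category \<S> C \<longleftrightarrow>
     is_category C \<and>
     (\<forall>J D E. small_category \<S> J \<and> is_diagram J C D E \<longrightarrow> (\<exists>c p. is_colimit J C D E c p))"


section \<open>Topos causal models\<close>

text \<open>
  Functions between sets are extensional, so that equality of functions is equality on the domain.
\<close>

record ('u, 'v) tcm =
  exo :: "'u set"
  endo :: "'v set"
  mech :: "'u \<Rightarrow> 'v"

definition tcm_hom ::
  "('u, 'v) tcm \<Rightarrow> ('u, 'v) tcm \<Rightarrow> (('u \<Rightarrow> 'u) \<times> ('v \<Rightarrow> 'v)) set" where
  "tcm_hom X Y =
     {(h, g). h \<in> exo X \<rightarrow>\<^sub>E exo Y \<and> g \<in> endo X \<rightarrow>\<^sub>E endo Y \<and>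
              (\<forall>u\<in>exo X. g (mech X u) = mech Y (h u))}"

definition tcm_id :: "('u, 'v) tcm \<Rightarrow> ('u \<Rightarrow> 'u) \<times> ('v \<Rightarrow> 'v)" where
  "tcm_id X = ((\<lambda>u\<in>exo X. u), (\<lambda>v\<in>endo X. v))"

definition tcm_comp ::
  "('u, 'v) tcm \<Rightarrow> ('u \<Rightarrow> 'u) \<times> ('v \<Rightarrow> 'v) \<Rightarrow> ('u \<Rightarrow> 'u) \<times> ('v \<Rightarrow> 'v) \<Rightarrow>
   ('u \<Rightarrow> 'u) \<times> ('v \<Rightarrow> 'v)" where
  "tcm_comp X k l = (compose (exo X) (fst k) (fst l), compose (endo X) (snd k) (snd l))"

definition TCM :: "'a set set \<Rightarrow> (('a, 'a) tcm, ('a \<Rightarrow> 'a) \<times> ('a \<Rightarrow> 'a)) category" where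
  "TCM \<U> =
     \<lparr>Obj = {X. exo X \<in> \<U> \<and> endo X \<in> \<U> \<and> mech X \<in> exo X \<rightarrow>\<^sub>E endo X},
      Hom = tcm_hom,
      Ident = tcm_id,
      Comp = (\<lambda>X Y Z. tcm_comp X)\<rparr>"


section \<open>Structural causal models\<close>

text \<open>
  The endogenous variables are indexed by \<open>0, \<dots>, n - 1\<close>; a realization of all of them is a
  function in \<open>\<Pi>\<^sub>E i\<in>{..<n}. V\<^sub>i\<close>.
\<close>

record 'a scm =
  exos :: "'a set"
  nvars :: nat
  vals :: "nat \<Rightarrow> 'a set"
  loc :: "nat \<Rightarrow> 'a \<times> (nat \<Rightarrow> 'a) \<Rightarrow> 'a"

definition endos :: "'a scm \<Rightarrow> (nat \<Rightarrow> 'a) set" where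
  "endos M = (\<Pi>\<^sub>E i\<in>{..<nvars M}. vals M i)"

definition others :: "'a scm \<Rightarrow> nat \<Rightarrow> nat set" where
  "others M i = {..<nvars M} - {i}"

definition solves :: "'a scm \<Rightarrow> 'a \<Rightarrow> (nat \<Rightarrow> 'a) \<Rightarrow> bool" where
  "solves M u v \<longleftrightarrow>
     v \<in> endos M \<and> (\<forall>i<nvars M. v i = loc M i (u, restrict v (others M i)))"

definition is_scm :: "'a set set \<Rightarrow> 'a scm \<Rightarrow> bool" where
  "is_scm \<U> M \<longleftrightarrow>
     exos M \<in> \<U> \<and>
     vals M \<in> {..<nvars M} \<rightarrow>\<^sub>E \<U> \<and>
     loc M \<in> (\<Pi>\<^sub>E i\<in>{..<nvars M}. exos M \<times> (\<Pi>\<^sub>E j\<in>others M i. vals M j) \<rightarrow>\<^sub>E vals M i) \<and>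
     (\<forall>u\<in>exos M. \<exists>!v. solves M u v)"

definition induced :: "'a scm \<Rightarrow> ('a, nat \<Rightarrow> 'a) tcm" where
  "induced M = \<lparr>exo = exos M, endo = endos M, mech = (\<lambda>u\<in>exos M. THE v. solves M u v)\<rparr>"

definition SCM ::
  "'a set set \<Rightarrow> ('a scm, ('a \<Rightarrow> 'a) \<times> ((nat \<Rightarrow> 'a) \<Rightarrow> (nat \<Rightarrow> 'a))) category" where
  "SCM \<U> =
     \<lparr>Obj = {M. is_scm \<U> M},
      Hom = (\<lambda>M N. tcm_hom (induced M) (induced N)),
      Ident = (\<lambda>M. tcm_id (induced M)),
      Comp = (\<lambda>M N P. tcm_comp (induced M))\<rparr>"

text \<open>
  The function induced by a structural causal model is a topos causal model: it maps into the set
  of realizations of the endogenous variables, and its values are the solutions.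
\<close>

lemma mech_induced:
  assumes "is_scm \<U> M"
  shows "mech (induced M) \<in> exos M \<rightarrow>\<^sub>E endos M"
    and "u \<in> exos M \<Longrightarrow> solves M u (mech (induced M) u)"
proof -
  have *: "solves M u (THE v. solves M u v)" if "u \<in> exos M" for u
    using assms that theI'[of "solves M u"] by (auto simp: is_scm_def)
  then show "u \<in> exos M \<Longrightarrow> solves M u (mech (induced M) u)"
    by (simp add: induced_def)
  from * show "mech (induced M) \<in> exos M \<rightarrow>\<^sub>E endos M"
    by (auto simp: induced_def solves_def)
qed

end

theory Submission
  imports Defs
begin

text \<open>
  Every hom-set and every composite in \<open>SCM\<close> is that of the induced functions, so both categories
  are full categories of arrows \<open>F : U \<rightarrow> V\<close> between sets, and their limits and colimits are computed
  separately on \<open>U\<close> and on \<open>V\<close>. The function of a limit or colimit comes from the universal property.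
  A structural causal model with a single endogenous variable has no constraint on its function,
  which provides a structural causal model for every arrow up to isomorphism. Realizations
  of finitely many variables form a set of the universe up to bijection, so the vertex stays
  inside the universe.
\<close>

section \<open>Limits and colimits of sets\<close>

text \<open>A cone from a one-point set, that is, an element of the limit. Values of
  \<open>x\<close> outside \<open>Obj J\<close> are left free.\<close>

definition matching ::
  "('j, 'k) category \<Rightarrow> ('j \<Rightarrow> 'v set) \<Rightarrow> ('j \<Rightarrow> 'j \<Rightarrow> 'k \<Rightarrow> 'v \<Rightarrow> 'v) \<Rightarrow> ('j \<Rightarrow> 'v) \<Rightarrow> bool" where
  "matching J X e x \<longleftrightarrow>
     (\<forall>i\<in>Obj J. x i \<in> X i) \<and>
     (\<forall>i\<in>Obj J. \<forall>j\<in>Obj J. \<forall>a\<in>Hom J i j. e i j a (x i) = x j)"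

text \<open>The compatibility condition of a cocone, with no target set fixed. The codomain type is
  polymorphic so that Boolean-valued families can serve as tests.\<close>

definition comatching ::
  "('j, 'k) category \<Rightarrow> ('j \<Rightarrow> 'v set) \<Rightarrow> ('j \<Rightarrow> 'j \<Rightarrow> 'k \<Rightarrow> 'v \<Rightarrow> 'v) \<Rightarrow> ('j \<Rightarrow> 'v \<Rightarrow> 'z) \<Rightarrow> bool" where
  "comatching J X e f \<longleftrightarrow>
     (\<forall>i\<in>Obj J. \<forall>j\<in>Obj J. \<forall>a\<in>Hom J i j. \<forall>x\<in>X i. f j (e i j a x) = f i x)"

text \<open>The set \<open>B\<close> parametrizes the matching families bijectively and may have any
  type, so the vertex can be moved to an equipollent set in the universe.\<close>

definition set_limit ::
  "('j, 'k) category \<Rightarrow> ('j \<Rightarrow> 'v set) \<Rightarrow> ('j \<Rightarrow> 'j \<Rightarrow> 'k \<Rightarrow> 'v \<Rightarrow> 'v) \<Rightarrow> 'b set \<Rightarrow> ('j \<Rightarrow> 'b \<Rightarrow> 'v) \<Rightarrow> bool"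
  where
  "set_limit J X e B r \<longleftrightarrow>
     (\<forall>b\<in>B. matching J X e (\<lambda>i. r i b)) \<and>
     (\<forall>x. matching J X e x \<longrightarrow> (\<exists>b\<in>B. \<forall>i\<in>Obj J. r i b = x i)) \<and>
     (\<forall>b\<in>B. \<forall>b'\<in>B. (\<forall>i\<in>Obj J. r i b = r i b') \<longrightarrow> b = b')"

text \<open>
  Two elements are identified in the colimit exactly if no compatible family of maps into
  a two-element set separates them. Unlike the universal property for all target sets, this is
  expressible without quantifying over types, and \<open>set_colimit_factor\<close> recovers the latter.
\<close>

definition set_colimit ::
  "('j, 'k) category \<Rightarrow> ('j \<Rightarrow> 'v set) \<Rightarrow> ('j \<Rightarrow> 'j \<Rightarrow> 'k \<Rightarrow> 'v \<Rightarrow> 'v) \<Rightarrow> 'b set \<Rightarrow> ('j \<Rightarrow> 'v \<Rightarrow> 'b) \<Rightarrow> bool"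
  where
  "set_colimit J X e B r \<longleftrightarrow>
     comatching J X e r \<and> B = (\<Union>i\<in>Obj J. r i ` X i) \<and>
     (\<forall>i\<in>Obj J. \<forall>x\<in>X i. \<forall>j\<in>Obj J. \<forall>y\<in>X j. r i x = r j y \<longrightarrow>
        (\<forall>f :: 'j \<Rightarrow> 'v \<Rightarrow> bool. comatching J X e f \<longrightarrow> f i x = f j y))"

lemma set_colimitD:
  assumes "set_colimit J X e B r"
  shows "i \<in> Obj J \<Longrightarrow> x \<in> X i \<Longrightarrow> r i x \<in> B"
    and "i \<in> Obj J \<Longrightarrow> x \<in> X i \<Longrightarrow> j \<in> Obj J \<Longrightarrow> a \<in> Hom J i j \<Longrightarrow> r j (e i j a x) = r i x"
    and "b \<in> B \<Longrightarrow> \<exists>i\<in>Obj J. \<exists>x\<in>X i. b = r i x"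
  using assms by (auto simp: set_colimit_def comatching_def)

text \<open>Boolean tests suffice: comparing \<open>f\<close> with one fixed value of
  \<open>f\<close> gives a compatible Boolean family, so elements of the same class have the same
  value under \<open>f\<close>. As \<open>B\<close> consists of classes only, \<open>f\<close>
  descends to \<open>B\<close>.\<close>

lemma set_colimit_factor:
  assumes B: "set_colimit J X e B r" and f: "comatching J X e f"
    and Z: "\<And>i x. i \<in> Obj J \<Longrightarrow> x \<in> X i \<Longrightarrow> f i x \<in> Z"
  obtains g where "g \<in> B \<rightarrow>\<^sub>E Z" "\<And>i x. i \<in> Obj J \<Longrightarrow> x \<in> X i \<Longrightarrow> g (r i x) = f i x"
proof -
  have eq: "f i x = f j y"
    if "i \<in> Obj J" "x \<in> X i" "j \<in> Obj J" "y \<in> X j" "r i x = r j y" for i x j y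
  proof -
    have "comatching J X e (\<lambda>k z. f k z = f i x)"
      using f by (simp add: comatching_def)
    then have "(f i x = f i x) = (f j y = f i x)"
      using B that unfolding set_colimit_def by blast
    then show ?thesis by simp
  qed
  \<comment> \<open>The value at a class is asserted for all representatives at once, so that a
    single choice of \<open>g\<close> serves every one of them.\<close>
  have "\<forall>b\<in>B. \<exists>z. z \<in> Z \<and> (\<forall>i\<in>Obj J. \<forall>x\<in>X i. r i x = b \<longrightarrow> f i x = z)"
  proof
    fix b assume "b \<in> B"
    then obtain i x where ix: "i \<in> Obj J" "x \<in> X i" "b = r i x"
      using set_colimitD(3)[OF B] by blast
    then show "\<exists>z. z \<in> Z \<and> (\<forall>i\<in>Obj J. \<forall>x\<in>X i. r i x = b \<longrightarrow> f i x = z)"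
    proof (intro exI[of _ "f i x"] conjI ballI impI)
      show "f i x \<in> Z" using Z ix by blast
      show "f j y = f i x" if "j \<in> Obj J" "y \<in> X j" "r j y = b" for j y
        using eq[OF that(1,2) ix(1,2)] that(3) ix(3) by blast
    qed
  qed
  from bchoice[OF this] obtain g where g: "\<forall>b\<in>B. g b \<in> Z \<and> (\<forall>i\<in>Obj J. \<forall>x\<in>X i. r i x = b \<longrightarrow> f i x = g b)"
    by (rule exE)
  note r = set_colimitD(1)[OF B]
  show ?thesis
  proof (rule that[of "restrict g B"])
    show "restrict g B \<in> B \<rightarrow>\<^sub>E Z" using g by simp
    show "restrict g B (r i x) = f i x" if "i \<in> Obj J" "x \<in> X i" for i x
      using bspec[OF g r[OF that]] r[OF that] that by simp
  qed
qed

section \<open>Transport of the vertex along a bijection\<close>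

lemma set_limit_transport:
  assumes "bij_betw t B L" and L: "set_limit J X e L r"
  shows "set_limit J X e B (\<lambda>i b. r i (t b))"
proof -
  have t: "inj_on t B" "t ` B = L"
    using assms(1) by (auto simp: bij_betw_def)
  show ?thesis
    unfolding set_limit_def
  proof (intro conjI ballI allI impI)
    show "matching J X e (\<lambda>i. r i (t b))" if "b \<in> B" for b
      using L t(2) that unfolding set_limit_def by blast
    show "\<exists>b\<in>B. \<forall>i\<in>Obj J. r i (t b) = x i" if "matching J X e x" for x
      using L t(2) that unfolding set_limit_def by blast
    show "b = b'" if "b \<in> B" "b' \<in> B" "\<forall>i\<in>Obj J. r i (t b) = r i (t b')" for b b'
    proof (rule inj_onD[OF t(1) _ that(1,2)])
      show "t b = t b'"
        using L t(2) that unfolding set_limit_def by blast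
    qed
  qed
qed

lemma set_colimit_transport:
  assumes "bij_betw t L B" and L: "set_colimit J X e L r"
  shows "set_colimit J X e B (\<lambda>i x. t (r i x))"
proof -
  have t: "inj_on t L" "t ` L = B"
    using assms(1) by (auto simp: bij_betw_def)
  note r = set_colimitD(1)[OF L]
  have "comatching J X e (\<lambda>i x. t (r i x))"
    using L by (simp add: set_colimit_def comatching_def)
  moreover have "B = (\<Union>i\<in>Obj J. (\<lambda>x. t (r i x)) ` X i)"
    using L t(2) by (auto simp: set_colimit_def)
  moreover have "f i x = f j y"
    if "i \<in> Obj J" "x \<in> X i" "j \<in> Obj J" "y \<in> X j" "t (r i x) = t (r j y)" "comatching J X e f"
    for i x j y and f :: "_ \<Rightarrow> _ \<Rightarrow> bool"
  proof -
    have "r i x = r j y"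
      using inj_onD[OF t(1) that(5)] r that by simp
    then show ?thesis
      using L that unfolding set_colimit_def by simp
  qed
  ultimately show ?thesis
    unfolding set_colimit_def by blast
qed

text \<open>Extensionality gives each matching family exactly one representative in the product,
  namely its restriction to \<open>Obj J\<close>.\<close>

lemma set_limit_of_matching:
  "set_limit J X e {x \<in> (\<Pi>\<^sub>E i\<in>Obj J. X i). matching J X e x} (\<lambda>i x. x i)"
  unfolding set_limit_def
proof (intro conjI allI impI ballI)
  fix x assume "matching J X e x"
  then show "\<exists>b\<in>{x \<in> (\<Pi>\<^sub>E i\<in>Obj J. X i). matching J X e x}. \<forall>i\<in>Obj J. b i = x i"
    by (intro bexI[of _ "restrict x (Obj J)"]) (auto simp: matching_def)
next
  fix b b' assume "b \<in> {x \<in> (\<Pi>\<^sub>E i\<in>Obj J. X i). matching J X e x}"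
    "b' \<in> {x \<in> (\<Pi>\<^sub>E i\<in>Obj J. X i). matching J X e x}" "\<forall>i\<in>Obj J. b i = b' i"
  then show "b = b'"
    by (intro PiE_ext[of b "Obj J" X b']) simp_all
qed simp

text \<open>The class of \<open>x\<close> in \<open>X i\<close> is encoded as the set of all
  compatible Boolean tests that hold at it. Tests are constant along the maps of the diagram, so
  \<open>r\<close> is compatible, and equal sets of tests mean agreement on every test. This
  replaces the quotient by the generated equivalence relation.\<close>

lemma set_colimit_of_comatching:
  fixes J :: "('j, 'k) category" and X :: "'j \<Rightarrow> 'v set" and e :: "'j \<Rightarrow> 'j \<Rightarrow> 'k \<Rightarrow> 'v \<Rightarrow> 'v"
  defines "r \<equiv> \<lambda>i x. {f :: 'j \<Rightarrow> 'v \<Rightarrow> bool. comatching J X e f \<and> f i x}"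
  shows "set_colimit J X e ((\<lambda>(i, x). r i x) ` (SIGMA i:Obj J. X i)) r"
  unfolding set_colimit_def
proof (intro conjI ballI allI impI)
  show "comatching J X e r"
    by (auto simp: comatching_def r_def)
  show "f i x = f j y" if "r i x = r j y" "comatching J X e f" for i x j y and f :: "'j \<Rightarrow> 'v \<Rightarrow> bool"
  proof -
    have "f \<in> r i x \<longleftrightarrow> f \<in> r j y" using that(1) by simp
    then show ?thesis using that(2) by (simp add: r_def)
  qed
qed auto


section \<open>Small sets\<close>

text \<open>Membership in \<open>\<U>\<close> is meaningful only for sets over the type
  \<open>'a\<close>. This version also covers products, disjoint unions and sets of realizations,
  which live in other types.\<close>

definition small_set :: "'a set set \<Rightarrow> 'b set \<Rightarrow> bool" where
  "small_set \<U> X \<longleftrightarrow> (\<exists>A\<in>\<U>. X \<lesssim> A)"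

lemma small_set_lepoll: "small_set \<U> Y \<Longrightarrow> X \<lesssim> Y \<Longrightarrow> small_set \<U> X"
  unfolding small_set_def by (meson lepoll_trans)

text \<open>The image of an injection into a member of \<open>\<U>\<close> is itself a member, since
  \<open>\<U>\<close> is closed downwards under \<lesssim>.\<close>

lemma small_set_eqpoll:
  assumes "set_universe \<S> \<U>" "small_set \<U> X"
  obtains A where "A \<in> \<U>" "A \<approx> X"
proof -
  from assms(2) obtain A f where A: "A \<in> \<U>" "inj_on f X" "f ` X \<subseteq> A"
    by (auto simp: small_set_def lepoll_def)
  have "\<forall>A\<in>\<U>. \<forall>B. B \<lesssim> A \<longrightarrow> B \<in> \<U>"
    using assms(1) by (simp add: set_universe_def)
  then have "f ` X \<in> \<U>"
    using A(1) subset_imp_lepoll[OF A(3)] by blast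
  then show ?thesis
    using that inj_on_image_eqpoll_self[OF A(2)] by blast
qed

lemma PiE_reindex_lepoll:
  assumes "bij_betw s I K"
  shows "(\<Pi>\<^sub>E k\<in>K. X k) \<lesssim> (\<Pi>\<^sub>E i\<in>I. X (s i))"
proof -
  have K: "K = s ` I"
    using assms by (simp add: bij_betw_def)
  have "inj_on (\<lambda>x. \<lambda>i\<in>I. x (s i)) (\<Pi>\<^sub>E k\<in>K. X k)"
  proof (rule inj_onI)
    fix x y assume xy: "x \<in> (\<Pi>\<^sub>E k\<in>K. X k)" "y \<in> (\<Pi>\<^sub>E k\<in>K. X k)"
      and eq: "(\<lambda>i\<in>I. x (s i)) = (\<lambda>i\<in>I. y (s i))"
    have "x (s i) = y (s i)" if "i \<in> I" for i
      using fun_cong[OF eq, of i] that by simp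
    then show "x = y"
      using xy by (intro PiE_ext[OF xy]) (auto simp: K)
  qed
  then show ?thesis
    unfolding lepoll_def K by (intro exI conjI) auto
qed

text \<open>Each factor is enlarged to a member of \<open>\<U>\<close>, where the closure axioms
  apply; products and disjoint unions are monotone for \<lesssim>, which brings the result
  back.\<close>

lemma
  assumes univ: "set_universe \<S> \<U>" and I: "I \<in> \<S>" and X: "\<And>i. i \<in> I \<Longrightarrow> small_set \<U> (X i)"
  shows small_set_PiE: "small_set \<U> (\<Pi>\<^sub>E i\<in>I. X i)"
    and small_set_Sigma: "small_set \<U> (SIGMA i:I. X i)"
proof -
  obtain Y where Y: "\<And>i. i \<in> I \<Longrightarrow> Y i \<in> \<U> \<and> X i \<lesssim> Y i"
    using X unfolding small_set_def by metis
  then have "(\<exists>A\<in>\<U>. A \<approx> (SIGMA i:I. Y i)) \<and> (\<exists>A\<in>\<U>. A \<approx> (\<Pi>\<^sub>E i\<in>I. Y i))"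
    using univ I unfolding set_universe_def by blast
  then have "small_set \<U> (\<Pi>\<^sub>E i\<in>I. Y i)" "small_set \<U> (SIGMA i:I. Y i)"
    unfolding small_set_def by (meson eqpoll_imp_lepoll eqpoll_sym)+
  moreover have "(\<Pi>\<^sub>E i\<in>I. X i) \<lesssim> (\<Pi>\<^sub>E i\<in>I. Y i)"
    using Y by (intro lepoll_PiE) blast
  moreover have "(SIGMA i:I. X i) \<lesssim> (SIGMA i:I. Y i)"
    using Y by (intro Sigma_lepoll_mono) auto
  ultimately show "small_set \<U> (\<Pi>\<^sub>E i\<in>I. X i)" "small_set \<U> (SIGMA i:I. X i)"
    by (blast intro: small_set_lepoll)+
qed

text \<open>The axioms speak of products indexed by members of \<open>\<S>\<close>, whereas
  \<open>{..<n}\<close> is a set of natural numbers. Every finite cardinality is small, so the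
  product can be reindexed over some \<open>S\<close> in \<open>\<S>\<close>.\<close>

lemma small_set_finite_PiE:
  assumes univ: "set_universe \<S> \<U>" and X: "\<And>i. i < n \<Longrightarrow> X i \<in> \<U>"
  shows "small_set \<U> (\<Pi>\<^sub>E i\<in>{..<n::nat}. X i)"
proof -
  obtain S s where S: "S \<in> \<S>" and s: "bij_betw s S {..<n}"
    using univ unfolding set_universe_def eqpoll_def by blast
  have "small_set \<U> (\<Pi>\<^sub>E i\<in>S. X (s i))"
  proof (rule small_set_PiE[OF univ S])
    fix i assume "i \<in> S"
    then have "X (s i) \<in> \<U>"
      using X s by (auto simp: bij_betw_def)
    then show "small_set \<U> (X (s i))"
      unfolding small_set_def by blast
  qed
  then show ?thesis
    using PiE_reindex_lepoll[OF s] by (rule small_set_lepoll)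
qed

text \<open>The matching families lie in a small product, so they are equipollent to a member of
  \<open>\<U>\<close> and then to one of \<open>\<W>\<close>. The latter may have another type than
  \<open>\<U>\<close>: for structural causal models it contains sets of functions.\<close>

lemma ex_set_limit:
  assumes univ: "set_universe \<S> \<U>" and J: "Obj J \<in> \<S>"
    and X: "\<And>i. i \<in> Obj J \<Longrightarrow> small_set \<U> (X i)"
    and W: "\<And>A. A \<in> \<U> \<Longrightarrow> \<exists>B\<in>\<W>. B \<approx> A"
  obtains B r where "B \<in> \<W>" "set_limit J X e B r"
proof -
  let ?L = "{x \<in> (\<Pi>\<^sub>E i\<in>Obj J. X i). matching J X e x}"
  have "small_set \<U> ?L"
    by (rule small_set_lepoll[OF small_set_PiE[OF univ J X]]) (auto intro: subset_imp_lepoll)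
  then obtain A where "A \<in> \<U>" "A \<approx> ?L"
    by (rule small_set_eqpoll[OF univ])
  then obtain B where "B \<in> \<W>" "B \<approx> ?L"
    using W eqpoll_trans by blast
  then show ?thesis
    using that set_limit_transport[OF _ set_limit_of_matching] unfolding eqpoll_def by blast
qed

lemma ex_set_colimit:
  assumes univ: "set_universe \<S> \<U>" and J: "Obj J \<in> \<S>"
    and X: "\<And>i. i \<in> Obj J \<Longrightarrow> small_set \<U> (X i)"
    and W: "\<And>A. A \<in> \<U> \<Longrightarrow> \<exists>B\<in>\<W>. B \<approx> A"
  obtains B r where "B \<in> \<W>" "set_colimit J X e B r"
proof -
  \<comment> \<open>Here \<open>L\<close> is the set of classes encoded by Boolean tests; as an
    image of the disjoint union it injects into it.\<close>
  obtain L :: "('a \<Rightarrow> 'd \<Rightarrow> bool) set set" and r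
    where L: "set_colimit J X e L r" "L \<lesssim> (SIGMA i:Obj J. X i)"
    using set_colimit_of_comatching image_lepoll by blast
  have "small_set \<U> L"
    by (rule small_set_lepoll[OF small_set_Sigma[OF univ J X] L(2)])
  then obtain A where "A \<in> \<U>" "A \<approx> L"
    by (rule small_set_eqpoll[OF univ])
  then obtain B where "B \<in> \<W>" "L \<approx> B"
    using W eqpoll_trans eqpoll_sym by blast
  then show ?thesis
    using that set_colimit_transport[OF _ L(1)] unfolding eqpoll_def by blast
qed


section \<open>Full categories of arrows\<close>

lemma tcm_homD:
  assumes "m \<in> tcm_hom X Y"
  shows "fst m \<in> exo X \<rightarrow>\<^sub>E exo Y" "snd m \<in> endo X \<rightarrow>\<^sub>E endo Y"
    and "u \<in> exo X \<Longrightarrow> snd m (mech X u) = mech Y (fst m u)"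
  using assms by (auto simp: tcm_hom_def)

lemma tcm_hom_eqI:
  assumes m: "m \<in> tcm_hom X Y" and m': "m' \<in> tcm_hom X Y"
    and "\<And>u. u \<in> exo X \<Longrightarrow> fst m u = fst m' u" and "\<And>v. v \<in> endo X \<Longrightarrow> snd m v = snd m' v"
  shows "m = m'"
  using PiE_ext[OF tcm_homD(1)[OF m] tcm_homD(1)[OF m']] PiE_ext[OF tcm_homD(2)[OF m] tcm_homD(2)[OF m']]
    assms(3,4) by (intro prod_eqI) blast+

text \<open>Both sides are extensional, the composite by the definition of \<open>compose\<close>
  and \<open>r\<close> as a morphism, so agreement on the domains decides equality.\<close>

lemma tcm_comp_eq_iff:
  assumes "r \<in> tcm_hom X Z"
  shows "tcm_comp X k l = r \<longleftrightarrow>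
    (\<forall>u\<in>exo X. fst k (fst l u) = fst r u) \<and> (\<forall>v\<in>endo X. snd k (snd l v) = snd r v)"
proof -
  have "fst r \<in> extensional (exo X)" "snd r \<in> extensional (endo X)"
    using tcm_homD(1,2)[OF assms] by (simp_all add: PiE_iff)
  then show ?thesis
    by (auto simp: tcm_comp_def compose_def prod_eq_iff fun_eq_iff extensional_def)
qed

text \<open>
  The objects are named by arbitrary data, and \<open>T\<close> is the arrow that an object stands for;
  \<open>\<W>\<close> collects codomains that suffice to realize every set of the universe up to bijection.
\<close>

locale arrow_category =
  fixes \<S> :: "'s set set" and \<U> :: "'u set set" and \<W> :: "'v set set"
    and Ob :: "'o set" and T :: "'o \<Rightarrow> ('u, 'v) tcm"
  assumes universe: "set_universe \<S> \<U>"
    and exo_T: "\<And>a. a \<in> Ob \<Longrightarrow> exo (T a) \<in> \<U>"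
    and endo_T: "\<And>a. a \<in> Ob \<Longrightarrow> small_set \<U> (endo (T a))"
    and mech_T: "\<And>a. a \<in> Ob \<Longrightarrow> mech (T a) \<in> exo (T a) \<rightarrow>\<^sub>E endo (T a)"
    and realize_set: "\<And>A. A \<in> \<U> \<Longrightarrow> \<exists>B\<in>\<W>. B \<approx> A"
    and realize_arrow: "\<And>A B F. A \<in> \<U> \<Longrightarrow> B \<in> \<W> \<Longrightarrow> F \<in> A \<rightarrow>\<^sub>E B \<Longrightarrow>
          \<exists>c\<in>Ob. T c = \<lparr>exo = A, endo = B, mech = F\<rparr>"
begin

definition Arr :: "('o, ('u \<Rightarrow> 'u) \<times> ('v \<Rightarrow> 'v)) category" where
  "Arr = \<lparr>Obj = Ob, Hom = (\<lambda>a b. tcm_hom (T a) (T b)), Ident = (\<lambda>a. tcm_id (T a)),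
          Comp = (\<lambda>a b c. tcm_comp (T a))\<rparr>"

lemma Arr_simps [simp]:
  "Obj Arr = Ob" "Hom Arr a b = tcm_hom (T a) (T b)" "Ident Arr a = tcm_id (T a)"
  "Comp Arr a b c = tcm_comp (T a)"
  by (simp_all add: Arr_def)

lemma is_category_Arr: "is_category Arr"
  unfolding is_category_def Arr_simps
proof (intro conjI ballI)
  fix a assume "a \<in> Ob"
  then show "tcm_id (T a) \<in> tcm_hom (T a) (T a)"
    using mech_T[of a] by (auto simp: tcm_id_def tcm_hom_def)
next
  fix a b c f g
  assume "a \<in> Ob" "b \<in> Ob" "c \<in> Ob" and "f \<in> tcm_hom (T a) (T b)" and "g \<in> tcm_hom (T b) (T c)"
  then show "tcm_comp (T a) g f \<in> tcm_hom (T a) (T c)"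
    using mech_T[of a] by (auto simp: tcm_comp_def tcm_hom_def compose_def PiE_iff Pi_iff)
next
  fix a b f
  assume f: "f \<in> tcm_hom (T a) (T b)"
  show "tcm_comp (T a) f (tcm_id (T a)) = f" "tcm_comp (T a) (tcm_id (T b)) f = f"
    using tcm_homD(1,2)[OF f] by (auto simp: tcm_comp_eq_iff[OF f] tcm_id_def PiE_iff)
next
  fix a b c d f g h
  assume f: "f \<in> tcm_hom (T a) (T b)"
  show "tcm_comp (T a) (tcm_comp (T b) h g) f = tcm_comp (T a) h (tcm_comp (T a) g f)"
    using tcm_homD(1,2)[OF f] by (auto simp: tcm_comp_def compose_def PiE_iff fun_eq_iff)
qed

lemma is_diagramD:
  assumes "is_diagram J Arr D E" "i \<in> Obj J"
  shows "D i \<in> Ob"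
    and "j \<in> Obj J \<Longrightarrow> a \<in> Hom J i j \<Longrightarrow> E i j a \<in> tcm_hom (T (D i)) (T (D j))"
  using assms by (auto simp: is_diagram_def)

section \<open>Limits of arrows\<close>

lemma ex_limit:
  assumes J: "Obj J \<in> \<S>" and diag: "is_diagram J Arr D E"
  shows "\<exists>c p. is_limit J Arr D E c p"
proof -
  note D = is_diagramD(1)[OF diag]
  note E = is_diagramD(2)[OF diag]
  define X Y e1 e2 where "X i = exo (T (D i))" and "Y i = endo (T (D i))"
    and "e1 i j a = fst (E i j a)" and "e2 i j a = snd (E i j a)" for i j a
  note defs = X_def Y_def e1_def e2_def
  have "small_set \<U> (X i)" if "i \<in> Obj J" for i
    using exo_T[OF D[OF that]] by (auto simp: small_set_def X_def)
  then obtain A p where A: "A \<in> \<U>" and p: "set_limit J X e1 A p"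
    by (rule ex_set_limit[OF universe J, where \<W> = \<U>]) (auto intro: eqpoll_refl)
  have "small_set \<U> (Y i)" if "i \<in> Obj J" for i
    using endo_T[OF D[OF that]] by (simp add: Y_def)
  then obtain B r where B: "B \<in> \<W>" and r: "set_limit J Y e2 B r"
    by (rule ex_set_limit[OF universe J _ realize_set])
  have p_mem: "p i u \<in> X i" and p_nat: "j \<in> Obj J \<Longrightarrow> a \<in> Hom J i j \<Longrightarrow> e1 i j a (p i u) = p j u"
    if "u \<in> A" "i \<in> Obj J" for u i j a
    using p that unfolding set_limit_def matching_def by blast+
  have r_mem: "r i v \<in> Y i" and r_nat: "j \<in> Obj J \<Longrightarrow> a \<in> Hom J i j \<Longrightarrow> e2 i j a (r i v) = r j v"
    if "v \<in> B" "i \<in> Obj J" for v i j a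
    using r that unfolding set_limit_def matching_def by blast+
  have p_inj: "u = u'" if "u \<in> A" "u' \<in> A" "\<And>i. i \<in> Obj J \<Longrightarrow> p i u = p i u'" for u u'
    using p that unfolding set_limit_def by blast
  have r_inj: "v = v'" if "v \<in> B" "v' \<in> B" "\<And>i. i \<in> Obj J \<Longrightarrow> r i v = r i v'" for v v'
    using r that unfolding set_limit_def by blast
  have mech_mem: "mech (T (D i)) x \<in> Y i" if "i \<in> Obj J" "x \<in> X i" for i x
    using mech_T[OF D] that by (auto simp: defs)
  have mech_nat: "e2 i j a (mech (T (D i)) x) = mech (T (D j)) (e1 i j a x)"
    if "i \<in> Obj J" "j \<in> Obj J" "a \<in> Hom J i j" "x \<in> X i" for i j a x
    using tcm_homD(3)[OF E] that by (auto simp: defs)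
  \<comment> \<open>By \<open>mech_nat\<close>, applying the mechanisms coordinatewise turns a
    matching family of exogenous values into one of endogenous values. The element of
    \<open>B\<close> representing it becomes the value of the vertex mechanism at
    \<open>u\<close>.\<close>
  have "\<exists>b\<in>B. \<forall>i\<in>Obj J. r i b = mech (T (D i)) (p i u)" if u: "u \<in> A" for u
  proof -
    have "matching J Y e2 (\<lambda>i. mech (T (D i)) (p i u))"
      using p_mem[OF u] p_nat[OF u] mech_mem mech_nat by (simp add: matching_def)
    then show ?thesis
      using r by (simp add: set_limit_def)
  qed
  then obtain F0 where F0: "\<forall>u\<in>A. F0 u \<in> B \<and> (\<forall>i\<in>Obj J. r i (F0 u) = mech (T (D i)) (p i u))"
    by metis
  define F where "F = restrict F0 A"
  have F: "F \<in> A \<rightarrow>\<^sub>E B" "\<And>u i. u \<in> A \<Longrightarrow> i \<in> Obj J \<Longrightarrow> r i (F u) = mech (T (D i)) (p i u)"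
    using F0 by (auto simp: F_def)
  obtain c where c: "c \<in> Ob" "T c = \<lparr>exo = A, endo = B, mech = F\<rparr>"
    using realize_arrow[OF A B F(1)] by blast
  \<comment> \<open>\<open>set_limit\<close> constrains the projections only on the vertex;
    restricting them makes them extensional, as the hom-sets require.\<close>
  define P where "P i = (restrict (p i) A, restrict (r i) B)" for i
  have P: "P i \<in> tcm_hom (T c) (T (D i))" if "i \<in> Obj J" for i
    using p_mem r_mem F that by (auto simp: tcm_hom_def P_def c(2) defs)
  have cone: "is_cone J Arr D E c P"
    unfolding is_cone_def Arr_simps
    using c(1) P p_nat r_nat by (simp add: tcm_comp_eq_iff[OF P]) (simp add: P_def c(2) defs)
  have "\<exists>!m. m \<in> tcm_hom (T d) (T c) \<and> (\<forall>i\<in>Obj J. tcm_comp (T d) (P i) m = q i)"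
    if q: "is_cone J Arr D E d q" for d q
  proof -
    have d: "d \<in> Ob" and q_hom: "\<And>i. i \<in> Obj J \<Longrightarrow> q i \<in> tcm_hom (T d) (T (D i))"
      and q_nat: "\<And>i j a. i \<in> Obj J \<Longrightarrow> j \<in> Obj J \<Longrightarrow> a \<in> Hom J i j \<Longrightarrow>
        tcm_comp (T d) (E i j a) (q i) = q j"
      using q by (auto simp: is_cone_def)
    have q1: "fst (q i) u \<in> X i" if "i \<in> Obj J" "u \<in> exo (T d)" for i u
      using tcm_homD(1)[OF q_hom] that by (auto simp: defs)
    have q2: "snd (q i) v \<in> Y i" if "i \<in> Obj J" "v \<in> endo (T d)" for i v
      using tcm_homD(2)[OF q_hom] that by (auto simp: defs)
    \<comment> \<open>Evaluating the cone \<open>q\<close> at a point gives a matching family, so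
      the mediating maps are found point by point.\<close>
    have "matching J X e1 (\<lambda>i. fst (q i) u)" if "u \<in> exo (T d)" for u
      using q1 q_nat that by (auto simp: matching_def tcm_comp_eq_iff[OF q_hom] defs)
    then have "\<forall>u\<in>exo (T d). \<exists>x\<in>A. \<forall>i\<in>Obj J. p i x = fst (q i) u"
      using p by (simp add: set_limit_def)
    then obtain h where h: "\<forall>u\<in>exo (T d). h u \<in> A \<and> (\<forall>i\<in>Obj J. p i (h u) = fst (q i) u)"
      by metis
    have "matching J Y e2 (\<lambda>i. snd (q i) v)" if "v \<in> endo (T d)" for v
      using q2 q_nat that by (auto simp: matching_def tcm_comp_eq_iff[OF q_hom] defs)
    then have "\<forall>v\<in>endo (T d). \<exists>y\<in>B. \<forall>i\<in>Obj J. r i y = snd (q i) v"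
      using r by (simp add: set_limit_def)
    then obtain g where g: "\<forall>v\<in>endo (T d). g v \<in> B \<and> (\<forall>i\<in>Obj J. r i (g v) = snd (q i) v)"
      by metis
    let ?m = "(restrict h (exo (T d)), restrict g (endo (T d)))"
    have md: "mech (T d) u \<in> endo (T d)" if "u \<in> exo (T d)" for u
      using mech_T[OF d] that by auto
    \<comment> \<open>The projections \<open>r i\<close> jointly separate points of
      \<open>B\<close>. After \<open>r i\<close> both sides become
      \<open>mech (T (D i)) (fst (q i) u)\<close>, since \<open>q i\<close> is a morphism.\<close>
    have "g (mech (T d) u) = F (h u)" if u: "u \<in> exo (T d)" for u
    proof (rule r_inj)
      show "F (h u) \<in> B" using F(1) h u by auto
      show "r i (g (mech (T d) u)) = r i (F (h u))" if "i \<in> Obj J" for i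
        using that g h u md F(2) tcm_homD(3)[OF q_hom] by simp
    qed (use g md u in blast)
    then have m: "?m \<in> tcm_hom (T d) (T c)"
      using g h md by (auto simp: tcm_hom_def c(2))
    show ?thesis
    proof (rule ex1I[of _ ?m])
      show "?m \<in> tcm_hom (T d) (T c) \<and> (\<forall>i\<in>Obj J. tcm_comp (T d) (P i) ?m = q i)"
        using m g h by (simp add: tcm_comp_eq_iff[OF q_hom]) (simp add: P_def)
    next
      fix m' assume m': "m' \<in> tcm_hom (T d) (T c) \<and> (\<forall>i\<in>Obj J. tcm_comp (T d) (P i) m' = q i)"
      then have mem: "u \<in> exo (T d) \<Longrightarrow> fst m' u \<in> A" "v \<in> endo (T d) \<Longrightarrow> snd m' v \<in> B" for u v
        using tcm_homD(1,2)[of m'] by (fastforce simp: c(2))+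
      have comp: "i \<in> Obj J \<Longrightarrow> u \<in> exo (T d) \<Longrightarrow> p i (fst m' u) = fst (q i) u"
        "i \<in> Obj J \<Longrightarrow> v \<in> endo (T d) \<Longrightarrow> r i (snd m' v) = snd (q i) v" for i u v
        using m' mem by (auto simp: tcm_comp_eq_iff[OF q_hom] P_def)
      show "m' = ?m"
      proof (rule tcm_hom_eqI[OF conjunct1[OF m'] m])
        show "fst m' u = fst ?m u" if "u \<in> exo (T d)" for u
          by (rule p_inj) (use that h comp mem in simp_all)
        show "snd m' v = snd ?m v" if "v \<in> endo (T d)" for v
          by (rule r_inj) (use that g comp mem in simp_all)
      qed
    qed
  qed
  with cone have "is_limit J Arr D E c P"
    by (simp add: is_limit_def)
  then show ?thesis by blast
qed

section \<open>Colimits of arrows\<close>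

lemma ex_colimit:
  assumes J: "Obj J \<in> \<S>" and diag: "is_diagram J Arr D E"
  shows "\<exists>c p. is_colimit J Arr D E c p"
proof -
  note D = is_diagramD(1)[OF diag]
  note E = is_diagramD(2)[OF diag]
  define X Y e1 e2 where "X i = exo (T (D i))" and "Y i = endo (T (D i))"
    and "e1 i j a = fst (E i j a)" and "e2 i j a = snd (E i j a)" for i j a
  note defs = X_def Y_def e1_def e2_def
  have "small_set \<U> (X i)" if "i \<in> Obj J" for i
    using exo_T[OF D[OF that]] by (auto simp: small_set_def X_def)
  then obtain A p where A: "A \<in> \<U>" and p: "set_colimit J X e1 A p"
    by (rule ex_set_colimit[OF universe J, where \<W> = \<U>]) (auto intro: eqpoll_refl)
  have "small_set \<U> (Y i)" if "i \<in> Obj J" for i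
    using endo_T[OF D[OF that]] by (simp add: Y_def)
  then obtain B r where B: "B \<in> \<W>" and r: "set_colimit J Y e2 B r"
    by (rule ex_set_colimit[OF universe J _ realize_set])
  note p_mem = set_colimitD(1)[OF p] and p_nat = set_colimitD(2)[OF p]
    and p_surj = set_colimitD(3)[OF p]
  note r_mem = set_colimitD(1)[OF r] and r_nat = set_colimitD(2)[OF r]
    and r_surj = set_colimitD(3)[OF r]
  have mech_mem: "mech (T (D i)) x \<in> Y i" if "i \<in> Obj J" "x \<in> X i" for i x
    using mech_T[OF D] that by (auto simp: defs)
  have mech_nat: "e2 i j a (mech (T (D i)) x) = mech (T (D j)) (e1 i j a x)"
    if "i \<in> Obj J" "j \<in> Obj J" "a \<in> Hom J i j" "x \<in> X i" for i j a x
    using tcm_homD(3)[OF E] that by (auto simp: defs)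
  \<comment> \<open>Sending \<open>x\<close> to the class of its mechanism value is compatible by
    \<open>mech_nat\<close> and \<open>r_nat\<close>, so it descends to classes and yields the
    mechanism \<open>F\<close> of the vertex.\<close>
  have "comatching J X e1 (\<lambda>i x. r i (mech (T (D i)) x))"
    unfolding comatching_def using r_nat mech_mem by (simp flip: mech_nat)
  then obtain F where F: "F \<in> A \<rightarrow>\<^sub>E B"
    "\<And>i x. i \<in> Obj J \<Longrightarrow> x \<in> X i \<Longrightarrow> F (p i x) = r i (mech (T (D i)) x)"
    using r_mem mech_mem by (auto elim: set_colimit_factor[OF p, where Z = B])
  obtain c where c: "c \<in> Ob" "T c = \<lparr>exo = A, endo = B, mech = F\<rparr>"
    using realize_arrow[OF A B F(1)] by blast
  define P where "P i = (restrict (p i) (X i), restrict (r i) (Y i))" for i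
  have P: "P i \<in> tcm_hom (T (D i)) (T c)" if "i \<in> Obj J" for i
    using p_mem r_mem F mech_mem that by (auto simp: tcm_hom_def P_def c(2) simp flip: X_def Y_def)
  \<comment> \<open>The maps in \<open>P\<close> are restricted to \<open>X i\<close> and
    \<open>Y i\<close>; to evaluate them after a map of the diagram, that map must land in the next
    domain.\<close>
  have e_mem: "x \<in> X i \<Longrightarrow> e1 i j a x \<in> X j" "y \<in> Y i \<Longrightarrow> e2 i j a y \<in> Y j"
    if "i \<in> Obj J" "j \<in> Obj J" "a \<in> Hom J i j" for i j a x y
    unfolding defs
    using PiE_mem[OF tcm_homD(1)[OF E[OF that]]] PiE_mem[OF tcm_homD(2)[OF E[OF that]]] by blast+
  have cone: "is_cocone J Arr D E c P"
    unfolding is_cocone_def Arr_simps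
    using c(1) P p_nat r_nat e_mem
    by (simp add: tcm_comp_eq_iff[OF P]) (simp add: P_def flip: defs)
  have "\<exists>!m. m \<in> tcm_hom (T c) (T d) \<and> (\<forall>i\<in>Obj J. tcm_comp (T (D i)) m (P i) = q i)"
    if q: "is_cocone J Arr D E d q" for d q
  proof -
    have q_hom: "\<And>i. i \<in> Obj J \<Longrightarrow> q i \<in> tcm_hom (T (D i)) (T d)"
      and q_nat: "\<And>i j a. i \<in> Obj J \<Longrightarrow> j \<in> Obj J \<Longrightarrow> a \<in> Hom J i j \<Longrightarrow>
        tcm_comp (T (D i)) (q j) (E i j a) = q i"
      using q by (auto simp: is_cocone_def)
    have q1: "fst (q i) x \<in> exo (T d)" if "i \<in> Obj J" "x \<in> X i" for i x
      using tcm_homD(1)[OF q_hom] that by (auto simp: defs)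
    have q2: "snd (q i) y \<in> endo (T d)" if "i \<in> Obj J" "y \<in> Y i" for i y
      using tcm_homD(2)[OF q_hom] that by (auto simp: defs)
    have "comatching J X e1 (\<lambda>i. fst (q i))"
      using q_nat by (auto simp: comatching_def tcm_comp_eq_iff[OF q_hom] defs)
    then obtain h where h: "h \<in> A \<rightarrow>\<^sub>E exo (T d)"
      "\<And>i x. i \<in> Obj J \<Longrightarrow> x \<in> X i \<Longrightarrow> h (p i x) = fst (q i) x"
      using q1 by (auto elim: set_colimit_factor[OF p, where Z = "exo (T d)"])
    have "comatching J Y e2 (\<lambda>i. snd (q i))"
      using q_nat by (auto simp: comatching_def tcm_comp_eq_iff[OF q_hom] defs)
    then obtain g where g: "g \<in> B \<rightarrow>\<^sub>E endo (T d)"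
      "\<And>i y. i \<in> Obj J \<Longrightarrow> y \<in> Y i \<Longrightarrow> g (r i y) = snd (q i) y"
      using q2 by (auto elim: set_colimit_factor[OF r, where Z = "endo (T d)"])
    \<comment> \<open>Every element of \<open>A\<close> is the class of some \<open>x\<close> in
      some \<open>X i\<close>, where the equation reduces to \<open>q i\<close> being a
      morphism.\<close>
    have "g (F u) = mech (T d) (h u)" if u: "u \<in> A" for u
    proof -
      obtain i x where ix: "i \<in> Obj J" "x \<in> X i" "u = p i x"
        using p_surj[OF u] by blast
      then have "g (F u) = snd (q i) (mech (T (D i)) x)"
        by (simp add: F(2) g(2) mech_mem)
      also have "\<dots> = mech (T d) (fst (q i) x)"
        using tcm_homD(3)[OF q_hom] ix by (simp add: X_def)
      finally show ?thesis
        using ix h(2) by simp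
    qed
    then have m: "(h, g) \<in> tcm_hom (T c) (T d)"
      using g(1) h(1) by (simp add: tcm_hom_def c(2))
    show ?thesis
    proof (rule ex1I[of _ "(h, g)"])
      show "(h, g) \<in> tcm_hom (T c) (T d) \<and> (\<forall>i\<in>Obj J. tcm_comp (T (D i)) (h, g) (P i) = q i)"
        using m g h by (simp add: tcm_comp_eq_iff[OF q_hom]) (simp add: P_def flip: defs)
    next
      fix m' assume m': "m' \<in> tcm_hom (T c) (T d) \<and> (\<forall>i\<in>Obj J. tcm_comp (T (D i)) m' (P i) = q i)"
      have comp: "i \<in> Obj J \<Longrightarrow> x \<in> X i \<Longrightarrow> fst m' (p i x) = fst (q i) x"
        "i \<in> Obj J \<Longrightarrow> y \<in> Y i \<Longrightarrow> snd m' (r i y) = snd (q i) y" for i x y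
        using m' by (auto simp: tcm_comp_eq_iff[OF q_hom] P_def simp flip: X_def Y_def)
      \<comment> \<open>Classes exhaust \<open>A\<close> and \<open>B\<close>, so the values on
        them, prescribed by \<open>q\<close>, determine the morphism.\<close>
      show "m' = (h, g)"
      proof (rule tcm_hom_eqI[OF conjunct1[OF m'] m])
        show "fst m' u = fst (h, g) u" if "u \<in> exo (T c)" for u
          using p_surj[of u] that comp h by (auto simp: c(2))
        show "snd m' v = snd (h, g) v" if "v \<in> endo (T c)" for v
          using r_surj[of v] that comp g by (auto simp: c(2))
      qed
    qed
  qed
  with cone have "is_colimit J Arr D E c P"
    by (simp add: is_colimit_def)
  then show ?thesis by blast
qed

lemma complete_Arr: "complete_category \<S> Arr"
  using is_category_Arr ex_limit by (auto simp: complete_category_def small_category_def)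

lemma cocomplete_Arr: "cocomplete_category \<S> Arr"
  using is_category_Arr ex_colimit by (auto simp: cocomplete_category_def small_category_def)

end


section \<open>Structural causal models with one endogenous variable\<close>

text \<open>The only variable has no others to depend on: its equation reads
  \<open>v 0 = F u 0\<close>, whose unique solution in the realizations is
  \<open>F u\<close>.\<close>

lemma ex_scm_of_arrow:
  assumes A: "A \<in> \<U>" and V: "V \<in> \<U>" and F: "F \<in> A \<rightarrow>\<^sub>E ({..<1::nat} \<rightarrow>\<^sub>E V)"
  shows "\<exists>M. is_scm \<U> M \<and> induced M = \<lparr>exo = A, endo = {..<1} \<rightarrow>\<^sub>E V, mech = F\<rparr>"
proof -
  \<comment> \<open>\<open>\<lambda>_. undefined\<close> is the sole element of the product over the
    empty set \<open>others M 0\<close>, and every realization restricts to it; the local function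
    thus reads off coordinate 0 of \<open>F u\<close>.\<close>
  define M where "M = \<lparr>exos = A, nvars = 1, vals = (\<lambda>i\<in>{..<1}. V),
    loc = (\<lambda>i\<in>{..<1}. \<lambda>x\<in>A \<times> {\<lambda>_. undefined}. F (fst x) 0)\<rparr>"
  have endos: "endos M = ({..<1} \<rightarrow>\<^sub>E V)"
    unfolding endos_def M_def by simp (rule PiE_cong, simp)
  have others: "others M 0 = {}"
    by (auto simp: others_def M_def)
  have F0: "F u 0 \<in> V" if "u \<in> A" for u
    using PiE_mem[OF PiE_mem[OF F that], of 0] by simp
  have solves: "solves M u v \<longleftrightarrow> v = F u" if u: "u \<in> A" for u v
  proof
    assume v: "solves M u v"
    show "v = F u"
    proof (rule PiE_ext)
      show "v \<in> {..<1} \<rightarrow>\<^sub>E V" using v by (simp add: solves_def endos)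
      show "F u \<in> {..<1} \<rightarrow>\<^sub>E V" using F u by blast
      show "v i = F u i" if "i \<in> {..<1}" for i
        using v u that others by (simp add: solves_def M_def restrict_def)
    qed
  next
    assume "v = F u"
    then show "solves M u v"
      using F u others by (auto simp: solves_def endos) (simp add: M_def restrict_def)
  qed
  have "is_scm \<U> M"
    unfolding is_scm_def
  proof (intro conjI)
    show "loc M \<in> (\<Pi>\<^sub>E i\<in>{..<nvars M}. exos M \<times> (\<Pi>\<^sub>E j\<in>others M i. vals M j) \<rightarrow>\<^sub>E vals M i)"
    proof -
      have "(\<lambda>x\<in>A \<times> {\<lambda>_. undefined}. F (fst x) 0) \<in> A \<times> {\<lambda>_. undefined} \<rightarrow>\<^sub>E V"
        using F0 by auto
      moreover have "others M i = {}" "vals M i = V" "loc M i = (\<lambda>x\<in>A \<times> {\<lambda>_. undefined}. F (fst x) 0)"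
        if "i \<in> {..<1}" for i
        using that others by (simp_all add: M_def)
      moreover have "nvars M = 1" "exos M = A" "loc M \<in> extensional {..<1}"
        by (simp_all add: M_def)
      ultimately show ?thesis
        unfolding PiE_iff by (simp only: PiE_empty_domain) simp
    qed
    show "\<forall>u\<in>exos M. \<exists>!v. solves M u v"
      using solves by (simp add: M_def)
  qed (use A V in \<open>auto simp: M_def\<close>)
  moreover have "induced M = \<lparr>exo = A, endo = {..<1} \<rightarrow>\<^sub>E V, mech = F\<rparr>"
  proof -
    have "(\<lambda>u\<in>A. THE v. solves M u v) = restrict F A"
      by (intro restrict_ext the_equality) (simp_all add: solves)
    also have "\<dots> = F"
      by (rule PiE_restrict[OF F])
    finally show ?thesis
      by (simp add: induced_def endos) (simp add: M_def)
  qed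
  ultimately show ?thesis by blast
qed

theorem theorem1:
  fixes \<S> :: "'s set set" and \<U> :: "'a set set"
  assumes "set_universe \<S> \<U>"
  shows "complete_category \<S> (TCM \<U>) \<and> cocomplete_category \<S> (TCM \<U>) \<and>
         complete_category \<S> (SCM \<U>) \<and> cocomplete_category \<S> (SCM \<U>)"
proof -
  \<comment> \<open>Every function between members of \<open>\<U>\<close> is an object itself, so
    \<open>T\<close> is the identity and \<open>\<W>\<close> is \<open>\<U>\<close>.\<close>
  interpret tcm: arrow_category \<S> \<U> \<U> "Obj (TCM \<U>)" "\<lambda>X. X"
    by unfold_locales
      (auto simp: TCM_def small_set_def assms intro: eqpoll_refl)
  \<comment> \<open>Diagrams may contain models with any finite number of variables, whose sets of
    realizations are small. Vertices are taken among single-variable models, so \<open>\<W>\<close>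
    collects the realization sets of these.\<close>
  interpret scm: arrow_category \<S> \<U> "{{..<1} \<rightarrow>\<^sub>E V | V. V \<in> \<U>}" "Obj (SCM \<U>)" induced
  proof
    show "set_universe \<S> \<U>" by (fact assms)
  next
    fix M assume M: "M \<in> Obj (SCM \<U>)"
    then have M: "is_scm \<U> M" by (simp add: SCM_def)
    then show "exo (induced M) \<in> \<U>"
      by (simp add: induced_def is_scm_def)
    show "small_set \<U> (endo (induced M))"
      using M small_set_finite_PiE[OF assms, of "nvars M" "vals M"]
      by (auto simp: induced_def endos_def is_scm_def)
    show "mech (induced M) \<in> exo (induced M) \<rightarrow>\<^sub>E endo (induced M)"
      using mech_induced(1)[OF M] by (simp add: induced_def)
  next
    fix V assume "V \<in> \<U>"
    \<comment> \<open>A realization of a single variable amounts to its value at index 0.\<close>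
    moreover have "({..<1::nat} \<rightarrow>\<^sub>E V) \<approx> V"
      using PiE_sing_eqpoll_self[of "0::nat"] by (simp add: lessThan_Suc)
    ultimately show "\<exists>B\<in>{{..<1::nat} \<rightarrow>\<^sub>E V | V. V \<in> \<U>}. B \<approx> V" by blast
  next
    fix A B and F :: "'a \<Rightarrow> nat \<Rightarrow> 'a"
    assume "A \<in> \<U>" "B \<in> {{..<1} \<rightarrow>\<^sub>E V | V. V \<in> \<U>}" "F \<in> A \<rightarrow>\<^sub>E B"
    then show "\<exists>c\<in>Obj (SCM \<U>). induced c = \<lparr>exo = A, endo = B, mech = F\<rparr>"
      using ex_scm_of_arrow by (fastforce simp: SCM_def)
  qed
  have "tcm.Arr = TCM \<U>"
    unfolding tcm.Arr_def by (simp add: TCM_def)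
  moreover have "scm.Arr = SCM \<U>"
    unfolding scm.Arr_def by (simp add: SCM_def)
  ultimately show ?thesis
    using tcm.complete_Arr tcm.cocomplete_Arr scm.complete_Arr scm.cocomplete_Arr by simp
qed

end
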